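(* Let $A,B>0$ and $$a_1(k)=1+\frac{A^2k^2}{4(k^2-B^2)^2}.$$ Then the zeros of $a_1(k)$ in $\{k\in\mathbb{C}:\operatorname{Im}k\ge0\}\setminus\{-B,B\}$ are as follows: (i) for $0<B<\frac A4$, $a_1$ has two purely imaginary simple zeros at $k=\mathrm{i}k_j$, $j=1,2$, $0<k_1<k_2$, where $k_j=\frac14\left(A+(-1)^j\sqrt{A^2-16B^2}\right)$; (ii) for $B>\frac A4$, $a_1$ has two simple zeros at $k=p_1$ and $k=-\bar p_1$, where $p_1=\frac14\left(-\sqrt{16B^2-A^2}+\mathrm{i}A\right)$; (iii) for $B=\frac A4$, $a_1$ has one purely imaginary zero of multiplicity two at $k=\mathrm{i}\frac A4$.
   Context: The function $a_1(k)$ is the spectral function associated with the pure oscillating step initial data $u_0(x)=0$ for $x<0$, $u_0(x)=A\cos 2Bx$ for $x\ge0$ of the nonlocal mKdV equation; the statement lists all zeros of $a_1$ in the indicated set. *)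

theory Defs
  imports "HOL-Complex_Analysis.Complex_Analysis"
begin

text \<open>At the excluded points \<open>k = \<plusminus>B\<close>, which are poles of the spectral function, HOL's totalised
  division gives the irrelevant value 1.\<close>

definition a1 :: "real \<Rightarrow> real \<Rightarrow> complex \<Rightarrow> complex" where
  "a1 A B k = 1 + (of_real A)\<^sup>2 * k\<^sup>2 / (4 * (k\<^sup>2 - (of_real B)\<^sup>2)\<^sup>2)"

definition a1_zeros :: "real \<Rightarrow> real \<Rightarrow> complex set" where
  "a1_zeros A B = {k \<in> {k. Im k \<ge> 0} - {- of_real B, of_real B}. a1 A B k = 0}"

definition kj :: "real \<Rightarrow> real \<Rightarrow> nat \<Rightarrow> real" where
  "kj A B j = 1/4 * (A + (-1) ^ j * sqrt (A\<^sup>2 - 16 * B\<^sup>2))"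

definition p1 :: "real \<Rightarrow> real \<Rightarrow> complex" where
  "p1 A B = 1/4 * (- of_real (sqrt (16 * B\<^sup>2 - A\<^sup>2)) + \<i> * of_real A)"

end

theory Submission imports Defs begin

text \<open>The numerator of \<open>a\<^sub>1\<close> is the difference of squares
  \<open>(2 (k\<^sup>2 - B\<^sup>2))\<^sup>2 - (\<i> A k)\<^sup>2\<close>. If \<open>p\<close>, \<open>q\<close> are the roots of the factor
  \<open>2 k\<^sup>2 - \<i> A k - 2 B\<^sup>2\<close>, those of the other factor are \<open>-p\<close>, \<open>-q\<close>. In all three
  cases \<open>p\<close> and \<open>q\<close> lie in the open upper half-plane, so they are exactly the zeros
  sought, and they coincide precisely when \<open>A = 4 B\<close>.\<close>

text \<open>Vieta's relations replace explicit roots, so one computation serves all three cases: up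
  to the factor 4, the numerator depends on \<open>A\<close> and \<open>B\<close> only through
  \<open>(p + q)\<^sup>2\<close> and \<open>p * q\<close>.\<close>

lemma a1_factorization:
  fixes p q k :: complex
  assumes sum: "p + q = \<i> * of_real A / 2" and prod: "p * q = - (of_real B)\<^sup>2"
    and "k \<noteq> of_real B" "k \<noteq> - of_real B"
  shows "a1 A B k = (k - p) * (k - q) * (k + p) * (k + q) / (k\<^sup>2 - (of_real B)\<^sup>2)\<^sup>2"
proof -
  have "k\<^sup>2 - (of_real B)\<^sup>2 = (k - of_real B) * (k + of_real B)"
    by (simp add: power2_eq_square algebra_simps)
  then have nz: "k\<^sup>2 - (of_real B)\<^sup>2 \<noteq> 0"
    using assms(3,4) by (simp add: add_eq_0_iff2)
  have "(of_real A)\<^sup>2 = - 4 * (p + q)\<^sup>2"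
    by (simp add: sum power_mult_distrib power_divide)
  moreover have "(k - p) * (k - q) * (k + p) * (k + q) = (k\<^sup>2 + p * q)\<^sup>2 - (p + q)\<^sup>2 * k\<^sup>2"
    by algebra
  ultimately show ?thesis
    using nz by (simp add: a1_def prod field_simps)
qed

lemma a1_zeros_eq:
  fixes p q :: complex
  assumes "p + q = \<i> * of_real A / 2" "p * q = - (of_real B)\<^sup>2"
    and "Im p > 0" "Im q > 0"
  shows "a1_zeros A B = {p, q}"
proof -
  have "a1 A B k = 0 \<longleftrightarrow> k = p \<or> k = q"
    if "Im k \<ge> 0" "k \<noteq> of_real B" "k \<noteq> - of_real B" for k
  proof -
    have "k\<^sup>2 \<noteq> (of_real B)\<^sup>2"
      using that by (simp add: power2_eq_iff)
    moreover have "k + p \<noteq> 0" "k + q \<noteq> 0"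
      using that assms(3,4) by (auto simp: complex_eq_iff)
    ultimately show ?thesis
      using that by (simp add: a1_factorization[OF assms(1,2)])
  qed
  moreover have "p \<noteq> of_real B" "p \<noteq> - of_real B" "q \<noteq> of_real B" "q \<noteq> - of_real B"
    using assms(3,4) by auto
  ultimately show ?thesis
    using assms(3,4) by (auto simp: a1_zeros_def)
qed

text \<open>Near \<open>p\<close>, only the factors \<open>k - p\<close> and \<open>k - q\<close>
  can vanish. The hypotheses are symmetric in \<open>p\<close> and \<open>q\<close>, so exchanging
  them gives the order at \<open>q\<close>.\<close>

lemma zorder_a1:
  fixes p q :: complex
  assumes "p + q = \<i> * of_real A / 2" "p * q = - (of_real B)\<^sup>2"
    and "Im p > 0" "Im q > 0"
  shows "zorder (a1 A B) p = (if p = q then 2 else 1)"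
proof -
  \<comment> \<open>The poles are real and \<open>p\<close> is not, so \<open>p\<close> lies in the
    open set \<open>S\<close> on which the factorization is valid.\<close>
  define S where "S = - {of_real B, - of_real B :: complex}"
  define h where "h k = (k + p) * (k + q) / (k\<^sup>2 - (of_real B)\<^sup>2)\<^sup>2" for k :: complex
  have S: "open S" "p \<in> S"
    using assms(3) by (auto simp: S_def intro!: finite_imp_closed)
  have nz: "k\<^sup>2 - (of_real B)\<^sup>2 \<noteq> 0" if "k \<in> S" for k
    using that by (auto simp: S_def power2_eq_iff)
  have h_hol: "h holomorphic_on S"
    unfolding h_def by (intro holomorphic_intros) (use nz in auto)
  have "p + p \<noteq> 0" "p + q \<noteq> 0"
    using assms(3,4) by (auto simp: complex_eq_iff)
  then have h_p: "h p \<noteq> 0"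
    using nz[OF S(2)] by (simp add: h_def)
  have a1_eq: "a1 A B k = h k * ((k - p) * (k - q))" if "k \<in> S" for k
    using that a1_factorization[OF assms(1,2), of k] by (simp add: S_def h_def)
  show ?thesis
  proof (cases "p = q")
    case True
    have "zorder (a1 A B) p = 2"
      using S h_hol h_p
      by (rule zorder_eqI) (use a1_eq True in \<open>simp add: power_int_numeral power2_eq_square\<close>)
    then show ?thesis using True by simp
  next
    case False
    have "zorder (a1 A B) p = 1"
    \<comment> \<open>At a simple zero the factor \<open>k - q\<close> joins the cofactor, which
      stays nonzero at \<open>p\<close> because \<open>p \<noteq> q\<close>.\<close>
    proof (rule zorder_eqI[OF S])
      show "(\<lambda>k. h k * (k - q)) holomorphic_on S"
        by (intro holomorphic_intros h_hol)
    qed (use False h_p a1_eq in \<open>simp_all add: mult_ac\<close>)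
    then show ?thesis using False by simp
  qed
qed

theorem proposition2p3:
  fixes A B :: real
  assumes "A > 0" and "B > 0"
  shows "(B < A / 4 \<longrightarrow>
            0 < kj A B 1 \<and> kj A B 1 < kj A B 2 \<and>
            a1_zeros A B = {\<i> * of_real (kj A B 1), \<i> * of_real (kj A B 2)} \<and>
            (\<forall>j\<in>{1, 2}. zorder (a1 A B) (\<i> * of_real (kj A B j)) = 1)) \<and>
         (B > A / 4 \<longrightarrow>
            p1 A B \<noteq> - cnj (p1 A B) \<and>
            a1_zeros A B = {p1 A B, - cnj (p1 A B)} \<and>
            zorder (a1 A B) (p1 A B) = 1 \<and>
            zorder (a1 A B) (- cnj (p1 A B)) = 1) \<and>
         (B = A / 4 \<longrightarrow>
            a1_zeros A B = {\<i> * of_real (A / 4)} \<and>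
            zorder (a1 A B) (\<i> * of_real (A / 4)) = 2)"
\<comment> \<open>The instantiation splits only the three implications apart; the conjunction
  concluding each case stays one goal.\<close>
proof (intro conjI[of "_ \<longrightarrow> _"] impI)
  assume "B < A / 4"
  then have "(4 * B)\<^sup>2 < A\<^sup>2"
    using assms by (intro power_strict_mono) auto
  then have disc: "A\<^sup>2 - 16 * B\<^sup>2 > 0"
    by (simp add: power_mult_distrib)
  define s where "s = sqrt (A\<^sup>2 - 16 * B\<^sup>2)"
  have s: "s > 0" "s\<^sup>2 = A\<^sup>2 - 16 * B\<^sup>2"
    using disc by (simp_all add: s_def)
  \<comment> \<open>Since \<open>s\<^sup>2 = A\<^sup>2 - 16 * B\<^sup>2 < A\<^sup>2\<close>; this
    puts the smaller root strictly above the real axis.\<close>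
  have "s < A"
    using s assms by (intro power2_less_imp_less[of s A]) auto
  define a b where "a = (A - s) / 4" and "b = (A + s) / 4"
  have k: "kj A B (Suc 0) = a" "kj A B 2 = b"
    by (simp_all add: kj_def s_def a_def b_def)
  have ab: "0 < a" "a < b"
    using s \<open>s < A\<close> by (simp_all add: a_def b_def)
  define p q where "p = \<i> * of_real a" and "q = \<i> * of_real b"
  have "p + q = \<i> * of_real A / 2"
    by (simp add: p_def q_def a_def b_def complex_eq_iff field_simps)
  moreover have "a * b = B\<^sup>2"
    using s(2) by (simp add: a_def b_def power2_eq_square field_simps)
  then have "p * q = - (of_real B)\<^sup>2"
    by (simp add: p_def q_def complex_eq_iff)
  moreover have "Im p > 0" "Im q > 0" "p \<noteq> q"
    using ab by (auto simp: p_def q_def)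
  ultimately show "0 < kj A B 1 \<and> kj A B 1 < kj A B 2 \<and>
      a1_zeros A B = {\<i> * of_real (kj A B 1), \<i> * of_real (kj A B 2)} \<and>
      (\<forall>j\<in>{1, 2}. zorder (a1 A B) (\<i> * of_real (kj A B j)) = 1)"
    using a1_zeros_eq[of p q A B] zorder_a1[of p q A B] zorder_a1[of q p A B] ab
    by (simp add: k ac_simps flip: p_def q_def)
next
  assume "B > A / 4"
  then have "A\<^sup>2 < (4 * B)\<^sup>2"
    using assms by (intro power_strict_mono) auto
  then have disc: "16 * B\<^sup>2 - A\<^sup>2 > 0"
    by (simp add: power_mult_distrib)
  define s where "s = sqrt (16 * B\<^sup>2 - A\<^sup>2)"
  have s: "s > 0" "s\<^sup>2 = 16 * B\<^sup>2 - A\<^sup>2"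
    using disc by (simp_all add: s_def)
  \<comment> \<open>Reflection in the imaginary axis keeps the imaginary part, so the sum is twice
    \<open>\<i> * Im p\<close>, and the product is minus the squared modulus of \<open>p\<close>,
    that is \<open>- (s\<^sup>2 + A\<^sup>2) / 16\<close>.\<close>
  define p q where "p = p1 A B" and "q = - cnj p"
  have p: "Re p = - s / 4" "Im p = A / 4"
    by (simp_all add: p_def p1_def s_def)
  have "p + q = \<i> * of_real A / 2"
    by (simp add: q_def p complex_eq_iff)
  moreover have "p * q = - (of_real B)\<^sup>2"
    using s(2) by (simp add: q_def p complex_eq_iff power2_eq_square field_simps)
  moreover have "Im p > 0" "Im q > 0" "p \<noteq> q"
    using s assms by (auto simp: q_def p complex_eq_iff)
  ultimately show "p1 A B \<noteq> - cnj (p1 A B) \<and>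
      a1_zeros A B = {p1 A B, - cnj (p1 A B)} \<and>
      zorder (a1 A B) (p1 A B) = 1 \<and> zorder (a1 A B) (- cnj (p1 A B)) = 1"
    using a1_zeros_eq[of p q A B] zorder_a1[of p q A B] zorder_a1[of q p A B]
    by (simp add: ac_simps flip: p_def q_def)
next
  assume B: "B = A / 4"
  \<comment> \<open>The discriminant vanishes here, so both general lemmas apply with
    \<open>q = p\<close>: the zero set \<open>{p, p}\<close> collapses and the order is 2.\<close>
  define p where "p = \<i> * of_real (A / 4)"
  have "p + p = \<i> * of_real A / 2" "p * p = - (of_real B)\<^sup>2" "Im p > 0"
    using assms by (simp_all add: p_def B complex_eq_iff power2_eq_square)
  then show "a1_zeros A B = {\<i> * of_real (A / 4)} \<and>
      zorder (a1 A B) (\<i> * of_real (A / 4)) = 2"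
    unfolding p_def[symmetric] using a1_zeros_eq[of p p A B] zorder_a1[of p p A B] by simp
qed

end
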